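(* Let $V$ be a function holomorphic in a neighborhood of $0\in\mathbb{C}$ with $V(0)=0$ and $V'(0)\neq 0$, let $W(z)=1/V'(z)$, let $Z$ be the functional inverse of $V$, so $Z(V(z))=z$, and let $Y=xW(D)$, where $D=d/dx$. Let $U$ be an open neighborhood of $0$ on which $V$ is holomorphic and injective, with inverse $Z:V(U)\to U$. Then for every $A\in U$, all complex $x$, and all sufficiently small complex $v$ (depending on $A$), $$e^{vY}e^{Ax}=e^{xZ(v+V(A))}.$$ In particular, $$e^{vY}1=e^{xZ(v)}$$ for all sufficiently small $v$.
   Context: For $f$ holomorphic on $U$, the operator $f(D)$ acts on the linear span $E$ of the functions $x^k e^{Ax}$ ($k\ge 0$, $A\in U$) by $f(D)\,(x^k e^{Ax})=\partial_A^k\bigl(f(A)e^{Ax}\bigr)$. In particular $f(D)e^{Ax}=f(A)e^{Ax}$, and on polynomials $f(D)$ is the (finitely acting) power series $\sum_j \frac{f^{(j)}(0)}{j!}D^j$. The symbol $x$ also denotes the operator of multiplication by $x$, so $Y=xW(D)$ means: first apply $W(D)$, then multiply by $x$. For $g\in E$, $e^{vY}g=\sum_{n\ge0}\frac{v^n}{n!}Y^n g$. *)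

theory Defs
  imports "HOL-Complex_Analysis.Complex_Analysis"
begin

definition exp_monom :: "nat \<Rightarrow> complex \<Rightarrow> complex \<Rightarrow> complex" where
  "exp_monom k A = (\<lambda>x. x ^ k * exp (A * x))"

definition exp_comb :: "(nat \<times> complex) set \<Rightarrow> (nat \<times> complex \<Rightarrow> complex) \<Rightarrow> complex \<Rightarrow> complex" where
  "exp_comb S c = (\<lambda>x. \<Sum>(k, A)\<in>S. c (k, A) * exp_monom k A x)"

definition exp_span :: "complex set \<Rightarrow> (complex \<Rightarrow> complex) set" where
  "exp_span U = {exp_comb S c | S c. finite S \<and> S \<subseteq> UNIV \<times> U}"

text \<open>
  The operator \<open>f(D)\<close> on \<open>exp_span U\<close>: the linear extension of
  \<open>x^k e^(Ax) \<mapsto> \<partial>_A^k (f(A) e^(Ax))\<close>, where the derivative in \<open>A\<close> is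
  taken at fixed \<open>x\<close>. The description operator selects a unique function because the
  functions \<open>x^k e^(Ax)\<close> are linearly independent; see \<open>symbol_op_exp_comb\<close> below.
  Outside \<open>exp_span U\<close> the value is unspecified.
\<close>

definition symbol_op ::
    "complex set \<Rightarrow> (complex \<Rightarrow> complex) \<Rightarrow> (complex \<Rightarrow> complex) \<Rightarrow> complex \<Rightarrow> complex" where
  "symbol_op U f g = (THE h. \<exists>S c. finite S \<and> S \<subseteq> UNIV \<times> U \<and> g = exp_comb S c \<and>
     h = (\<lambda>x. \<Sum>(k, A)\<in>S. c (k, A) * (deriv ^^ k) (\<lambda>a. f a * exp (a * x)) A))"

text \<open>
  \<open>e^(vT) g\<close> as a pointwise series; it is meaningful where that series converges, which has
  to be asserted separately.
\<close>

definition exp_op ::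
    "complex \<Rightarrow> ((complex \<Rightarrow> complex) \<Rightarrow> complex \<Rightarrow> complex) \<Rightarrow> (complex \<Rightarrow> complex) \<Rightarrow> complex \<Rightarrow> complex" where
  "exp_op v T g x = (\<Sum>n. v ^ n / fact n * (T ^^ n) g x)"

definition exp_op_converges ::
    "complex \<Rightarrow> ((complex \<Rightarrow> complex) \<Rightarrow> complex \<Rightarrow> complex) \<Rightarrow> (complex \<Rightarrow> complex) \<Rightarrow> complex \<Rightarrow> bool" where
  "exp_op_converges v T g x \<longleftrightarrow> summable (\<lambda>n. v ^ n / fact n * (T ^^ n) g x)"


lemma pderiv_iter_eq_0:
  fixes q :: "complex poly"
  shows "degree q < n \<Longrightarrow> (pderiv ^^ n) q = 0"
proof (induction n arbitrary: q)
  case (Suc n)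
  show ?case
  proof (cases "degree q = 0")
    case True
    then have "pderiv q = 0" by (simp add: pderiv_eq_0_iff)
    moreover have "(pderiv ^^ n) (0::complex poly) = 0" by (induction n) auto
    ultimately show ?thesis by (simp only: funpow_Suc_right o_apply)
  next
    case False
    with Suc.prems have "degree (pderiv q) < n" by (simp add: degree_pderiv)
    with Suc.IH show ?thesis by (simp only: funpow_Suc_right o_apply)
  qed
qed simp

lemma pderiv_plus_smult_eq_0:
  fixes q :: "complex poly"
  assumes "d \<noteq> 0" "pderiv q + smult d q = 0"
  shows "q = 0"
proof (rule ccontr)
  assume "q \<noteq> 0"
  have "coeff (pderiv q) (degree q) = 0"
    by (simp add: coeff_pderiv coeff_eq_0)
  with assms(2) have "d * lead_coeff q = 0"
    by (metis add_0 coeff_0 coeff_add coeff_smult)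
  with assms(1) \<open>q \<noteq> 0\<close> show False by simp
qed

lemma exp_poly_independent:
  fixes p :: "complex \<Rightarrow> complex poly"
  assumes "finite F" "\<And>x. (\<Sum>a\<in>F. poly (p a) x * exp (a * x)) = 0" "a \<in> F"
  shows "p a = 0"
  using assms
proof (induction F arbitrary: p a rule: finite_induct)
  case (insert b F)
  define T where "T = (\<lambda>(a::complex) r. pderiv r + smult (a - b) r)"
  have iter: "poly ((pderiv ^^ n) (p b)) x
      + (\<Sum>a\<in>F. poly ((T a ^^ n) (p a)) x * exp ((a - b) * x)) = 0" for n x
  proof (induction n arbitrary: x)
    case 0
    have "exp (- b * x) * (\<Sum>a\<in>insert b F. poly (p a) x * exp (a * x)) = 0"
      using insert.prems(1) by simp
    also have "exp (- b * x) * (\<Sum>a\<in>insert b F. poly (p a) x * exp (a * x))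
       = (\<Sum>a\<in>insert b F. poly (p a) x * exp ((a - b) * x))"
      unfolding sum_distrib_left
      by (rule sum.cong) (auto simp: left_diff_distrib simp flip: exp_add)
    finally show ?case using insert.hyps by simp
  next
    case (Suc n)
    define h where "h = (\<lambda>x. poly ((pderiv ^^ n) (p b)) x
      + (\<Sum>a\<in>F. poly ((T a ^^ n) (p a)) x * exp ((a - b) * x)))"
    have "(h has_field_derivative (poly ((pderiv ^^ Suc n) (p b)) x
      + (\<Sum>a\<in>F. poly ((T a ^^ Suc n) (p a)) x * exp ((a - b) * x)))) (at x)"
      unfolding h_def
    proof (intro DERIV_add DERIV_sum)
      show "(poly ((pderiv ^^ n) (p b)) has_field_derivative poly ((pderiv ^^ Suc n) (p b)) x) (at x)"
        using poly_DERIV[of "(pderiv ^^ n) (p b)" x] by simp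
    next
      fix a
      show "((\<lambda>x. poly ((T a ^^ n) (p a)) x * exp ((a - b) * x)) has_field_derivative
         poly ((T a ^^ Suc n) (p a)) x * exp ((a - b) * x)) (at x)"
        by (rule derivative_eq_intros poly_DERIV refl)+ (simp add: T_def ring_distribs)
    qed
    moreover have "h = (\<lambda>x. 0)" using Suc.IH by (simp add: h_def)
    ultimately have "((\<lambda>_. 0) has_field_derivative (poly ((pderiv ^^ Suc n) (p b)) x
      + (\<Sum>a\<in>F. poly ((T a ^^ Suc n) (p a)) x * exp ((a - b) * x)))) (at x)"
      by (simp only:)
    then show ?case by (rule DERIV_unique) (rule DERIV_const)
  qed
  have other: "p a = 0" if "a \<in> F" for a
  proof -
    define n where "n = Suc (degree (p b))"
    have "(\<Sum>a\<in>F. poly ((T a ^^ n) (p a)) x * exp (a * x)) = 0" for x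
    proof -
      have "(\<Sum>a\<in>F. poly ((T a ^^ n) (p a)) x * exp (a * x))
         = exp (b * x) * (\<Sum>a\<in>F. poly ((T a ^^ n) (p a)) x * exp ((a - b) * x))"
        unfolding sum_distrib_left
        by (rule sum.cong) (auto simp: left_diff_distrib simp flip: exp_add)
      also have "\<dots> = 0"
        using iter[of n x] pderiv_iter_eq_0[of "p b" n] by (simp add: n_def del: funpow.simps)
      finally show ?thesis .
    qed
    then have 0: "(T a ^^ n) (p a) = 0"
      using insert.IH[of "\<lambda>a. (T a ^^ n) (p a)" a] that by blast
    have "a - b \<noteq> 0" using insert.hyps that by auto
    have "r = 0" if "(T a ^^ m) r = 0" for m r
      using that
    proof (induction m)
      case (Suc m)
      then have "pderiv ((T a ^^ m) r) + smult (a - b) ((T a ^^ m) r) = 0"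
        by (simp add: T_def)
      with \<open>a - b \<noteq> 0\<close> have "(T a ^^ m) r = 0" by (rule pderiv_plus_smult_eq_0)
      then show ?case by (rule Suc.IH)
    qed simp
    from this[OF 0] show ?thesis .
  qed
  have "poly (p b) x = 0" for x
    using iter[of 0 x] other by simp
  then have "p b = 0" using poly_all_0_iff_0 by blast
  with other insert.prems(2) show ?case by auto
qed simp

lemma exp_comb_eq_0:
  assumes "finite S" "exp_comb S c = (\<lambda>x. 0)" "p \<in> S"
  shows "c p = 0"
proof -
  define F where "F = snd ` S"
  define K where "K = fst ` S"
  have fin: "finite F" "finite K" using assms(1) by (auto simp: F_def K_def)
  define c' where "c' = (\<lambda>p. if p \<in> S then c p else 0)"
  define P where "P = (\<lambda>A. \<Sum>k\<in>K. monom (c' (k, A)) k)"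
  have "(\<Sum>A\<in>F. poly (P A) x * exp (A * x)) = 0" for x
  proof -
    have "(\<Sum>A\<in>F. poly (P A) x * exp (A * x))
      = (\<Sum>A\<in>F. \<Sum>k\<in>K. c' (k, A) * exp_monom k A x)"
      by (simp add: P_def poly_sum poly_monom sum_distrib_right exp_monom_def mult.assoc)
    also have "\<dots> = (\<Sum>(k, A)\<in>K \<times> F. c' (k, A) * exp_monom k A x)"
      by (subst sum.swap) (simp add: sum.cartesian_product)
    also have "\<dots> = (\<Sum>(k, A)\<in>S. c (k, A) * exp_monom k A x)"
      using fin
      by (intro sum.mono_neutral_cong_right) (auto simp: c'_def F_def K_def intro: rev_image_eqI)
    also have "\<dots> = 0" using fun_cong[OF assms(2), of x] by (simp add: exp_comb_def)
    finally show ?thesis .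
  qed
  moreover obtain k A where p: "p = (k, A)" by force
  moreover have "A \<in> F" "k \<in> K" using assms(3) p by (force simp: F_def K_def)+
  ultimately have "P A = 0" using exp_poly_independent[OF fin(1)] by blast
  then have "coeff (P A) k = 0" by simp
  then have "c' (k, A) = 0"
    using fin \<open>k \<in> K\<close> by (simp add: P_def coeff_sum)
  then show ?thesis using assms(3) p by (simp add: c'_def)
qed

lemma exp_comb_extend:
  fixes G :: "nat \<times> complex \<Rightarrow> complex"
  assumes "finite R" "S \<subseteq> R"
  shows "(\<Sum>p\<in>S. c p * G p) = (\<Sum>p\<in>R. (if p \<in> S then c p else 0) * G p)"
  using assms by (intro sum.mono_neutral_cong_left) auto

lemma symbol_op_exp_comb:
  assumes "finite S" "S \<subseteq> UNIV \<times> U"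
  shows "symbol_op U f (exp_comb S c)
    = (\<lambda>x. \<Sum>(k, A)\<in>S. c (k, A) * (deriv ^^ k) (\<lambda>a. f a * exp (a * x)) A)"
proof -
  define H where "H = (\<lambda>S c x. \<Sum>(k, A)\<in>S. c (k, A) * (deriv ^^ k) (\<lambda>a. f a * exp (a * x)) A)"
  have unique: "H S1 c1 = H S2 c2"
    if fin: "finite S1" "finite S2" and eq: "exp_comb S1 c1 = exp_comb S2 c2" for S1 S2 c1 c2
  proof -
    define R where "R = S1 \<union> S2"
    define d1 where "d1 = (\<lambda>p. if p \<in> S1 then c1 p else 0)"
    define d2 where "d2 = (\<lambda>p. if p \<in> S2 then c2 p else 0)"
    have R: "finite R" "S1 \<subseteq> R" "S2 \<subseteq> R" using fin by (auto simp: R_def)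
    have s1: "(\<Sum>p\<in>S1. c1 p * G p) = (\<Sum>p\<in>R. d1 p * G p)" for G
      unfolding d1_def using R by (intro exp_comb_extend) auto
    have s2: "(\<Sum>p\<in>S2. c2 p * G p) = (\<Sum>p\<in>R. d2 p * G p)" for G
      unfolding d2_def using R by (intro exp_comb_extend) auto
    have "exp_comb R (\<lambda>p. d1 p - d2 p) = (\<lambda>x. 0)"
    proof
      fix x
      have "exp_comb R (\<lambda>p. d1 p - d2 p) x = exp_comb S1 c1 x - exp_comb S2 c2 x"
        using s1[of "\<lambda>(k, A). exp_monom k A x"] s2[of "\<lambda>(k, A). exp_monom k A x"]
        by (simp add: exp_comb_def case_prod_unfold left_diff_distrib sum_subtractf)
      then show "exp_comb R (\<lambda>p. d1 p - d2 p) x = 0" using eq by simp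
    qed
    then have "d1 p = d2 p" if "p \<in> R" for p
      using exp_comb_eq_0[of R "\<lambda>p. d1 p - d2 p" p] R(1) that by simp
    then have "(\<Sum>p\<in>S1. c1 p * G p) = (\<Sum>p\<in>S2. c2 p * G p)" for G
      unfolding s1 s2 by (intro sum.cong) auto
    then show ?thesis by (simp add: H_def case_prod_unfold)
  qed
  have op: "symbol_op U f g = (THE h. \<exists>S c. finite S \<and> S \<subseteq> UNIV \<times> U \<and> g = exp_comb S c \<and>
      h = H S c)" for g
    by (simp add: symbol_op_def H_def)
  have "symbol_op U f (exp_comb S c) = H S c"
    unfolding op
  proof (rule the_equality)
    show "\<exists>S' c'. finite S' \<and> S' \<subseteq> UNIV \<times> U \<and> exp_comb S c = exp_comb S' c' \<and> H S c = H S' c'"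
      using assms by blast
  next
    fix h
    assume "\<exists>S' c'. finite S' \<and> S' \<subseteq> UNIV \<times> U \<and> exp_comb S c = exp_comb S' c' \<and> h = H S' c'"
    then show "h = H S c" using unique assms(1) by metis
  qed
  then show ?thesis by (simp add: H_def)
qed

lemma symbol_op_exp_monom:
  assumes "A \<in> U"
  shows "symbol_op U f (exp_monom k A) = (\<lambda>x. (deriv ^^ k) (\<lambda>a. f a * exp (a * x)) A)"
  using symbol_op_exp_comb[of "{(k, A)}" U f "\<lambda>_. 1"] assms by (simp add: exp_comb_def)

end

theory Submission
  imports Defs
begin

text \<open>
  Put \<open>w = V A\<close>. By the chain rule \<open>(d/dw)^n (h \<circ> Z)\<close> is a combination of the derivatives
  \<open>h^(k) \<circ> Z\<close> with coefficients \<open>C k w\<close> that do not depend on \<open>h\<close>. Taking \<open>h a = e^(ax)\<close>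
  exhibits \<open>(d/dw)^n e^(x Z w)\<close> as the element \<open>\<Sum>k. C k w * x^k e^(Ax)\<close> of the exponential span;
  applying \<open>x W(D)\<close> replaces \<open>h\<close> by \<open>x W(a) e^(ax)\<close>, for which \<open>h \<circ> Z = d/dw e^(x Z w)\<close>. Hence
  \<open>Y^n e^(Ax) = (d/dw)^n e^(x Z w)\<close>, and the series in \<open>v\<close> is a Taylor series, converging on a
  disc around \<open>V A\<close> that does not depend on \<open>x\<close>.
\<close>

text \<open>Iterating the chain and product rules never looks inside \<open>h\<close>, so one family
  \<open>C\<close> serves every \<open>h\<close>; this order of quantifiers is what allows two
  different \<open>h\<close> to be compared later. Holomorphy of \<open>C k\<close> is carried along
  because the next step differentiates it.\<close>

lemma higher_deriv_compose_expansion: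
  fixes Z :: "complex \<Rightarrow> complex"
  assumes "open S" "Z holomorphic_on S" "open U" "Z ` S \<subseteq> U"
  shows "\<exists>C. (\<forall>k. C k holomorphic_on S) \<and>
    (\<forall>h. h holomorphic_on U \<longrightarrow> (\<forall>w\<in>S.
      (deriv ^^ n) (\<lambda>w. h (Z w)) w = (\<Sum>k\<le>n. C k w * (deriv ^^ k) h (Z w))))"
proof (induction n)
  case 0
  show ?case by (intro exI[of _ "\<lambda>_ _. 1"]) auto
next
  case (Suc n)
  then obtain C where C: "\<And>k. C k holomorphic_on S"
    and eq: "\<And>h w. h holomorphic_on U \<Longrightarrow> w \<in> S \<Longrightarrow>
      (deriv ^^ n) (\<lambda>w. h (Z w)) w = (\<Sum>k\<le>n. C k w * (deriv ^^ k) h (Z w))"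
    by blast
  \<comment> \<open>The product rule either differentiates \<open>C k\<close> or raises the order of
    the derivative of \<open>h\<close>, whence the shift to \<open>k - 1\<close>. The cutoff
    \<open>k \<le> n\<close> matters: the induction hypothesis uses no \<open>C k\<close> beyond
    \<open>n\<close>, so its derivative must not enter at \<open>k = Suc n\<close>.\<close>
  define C' where "C' = (\<lambda>k w. (if k \<le> n then deriv (C k) w else 0) +
    (if k = 0 then 0 else C (k - 1) w * deriv Z w))"
  have "C' k holomorphic_on S" for k
    unfolding C'_def using C assms(1,2)
    by (cases "k \<le> n"; cases "k = 0") (auto intro!: holomorphic_intros)
  moreover have "(deriv ^^ Suc n) (\<lambda>w. h (Z w)) w = (\<Sum>k\<le>Suc n. C' k w * (deriv ^^ k) h (Z w))"
    if h: "h holomorphic_on U" and w: "w \<in> S" for h w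
  proof -
    have "((\<lambda>w. \<Sum>k\<le>n. C k w * (deriv ^^ k) h (Z w)) has_field_derivative
        (\<Sum>k\<le>n. deriv (C k) w * (deriv ^^ k) h (Z w) +
          C k w * ((deriv ^^ Suc k) h (Z w) * deriv Z w))) (at w)"
    proof (intro DERIV_sum)
      fix k
      have "(C k has_field_derivative deriv (C k) w) (at w)"
        using C assms(1) w holomorphic_derivI by blast
      moreover have "(Z has_field_derivative deriv Z w) (at w)"
        using assms(1,2) w holomorphic_derivI by blast
      moreover have "((deriv ^^ k) h has_field_derivative (deriv ^^ Suc k) h (Z w)) (at (Z w))"
        using holomorphic_derivI[OF holomorphic_higher_deriv[OF h assms(3), of k] assms(3)]
          assms(4) w by auto
      ultimately show "((\<lambda>w. C k w * (deriv ^^ k) h (Z w)) has_field_derivative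
          deriv (C k) w * (deriv ^^ k) h (Z w) +
          C k w * ((deriv ^^ Suc k) h (Z w) * deriv Z w)) (at w)"
        by (auto intro!: derivative_eq_intros DERIV_chain2[where f = "(deriv ^^ k) h"] simp del: funpow.simps)
    qed
    then have "((deriv ^^ n) (\<lambda>w. h (Z w)) has_field_derivative
        (\<Sum>k\<le>n. deriv (C k) w * (deriv ^^ k) h (Z w) +
          C k w * ((deriv ^^ Suc k) h (Z w) * deriv Z w))) (at w)"
      by (rule has_field_derivative_transform_within_open[OF _ assms(1) w]) (simp add: eq[OF h])
    then have "(deriv ^^ Suc n) (\<lambda>w. h (Z w)) w =
        (\<Sum>k\<le>n. deriv (C k) w * (deriv ^^ k) h (Z w)) +
        (\<Sum>k\<le>n. C k w * deriv Z w * (deriv ^^ Suc k) h (Z w))"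
      by (simp add: DERIV_imp_deriv sum.distrib mult_ac)
    also have "(\<Sum>k\<le>n. deriv (C k) w * (deriv ^^ k) h (Z w)) =
        (\<Sum>k\<le>Suc n. (if k \<le> n then deriv (C k) w else 0) * (deriv ^^ k) h (Z w))"
      by simp
    also have "(\<Sum>k\<le>n. C k w * deriv Z w * (deriv ^^ Suc k) h (Z w)) =
        (\<Sum>k\<le>Suc n. (if k = 0 then 0 else C (k - 1) w * deriv Z w) * (deriv ^^ k) h (Z w))"
      by (subst sum.atMost_Suc_shift) simp
    finally show ?thesis
      by (simp only: C'_def distrib_right sum.distrib)
  qed
  ultimately show ?case by blast
qed

lemma deriv_exp_linear_iter:
  "(deriv ^^ k) (\<lambda>a. exp (a * x)) = (\<lambda>a. x ^ k * exp (a * (x::complex)))"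
proof (induction k)
  case (Suc k)
  have "((\<lambda>a. x ^ k * exp (a * x)) has_field_derivative x ^ Suc k * exp (a * x)) (at a)" for a
    by (auto intro!: derivative_eq_intros)
  then show ?case
    by (simp add: Suc.IH DERIV_imp_deriv fun_eq_iff)
qed simp

text \<open>Since \<open>symbol_op\<close> is determined only on the exponential span, each
  induction step first writes the current iterate as an \<open>exp_comb\<close> with the single
  frequency \<open>A\<close>.\<close>

lemma Y_iter_exp:
  fixes V Z W :: "complex \<Rightarrow> complex"
    and Y :: "(complex \<Rightarrow> complex) \<Rightarrow> complex \<Rightarrow> complex"
  assumes U: "open U" and V: "V holomorphic_on U" "inj_on V U"
    and Z: "\<And>z. z \<in> U \<Longrightarrow> Z (V z) = z" and A: "A \<in> U"
    and W_def: "W = (\<lambda>z. 1 / deriv V z)" and Y_def: "Y = (\<lambda>g x. x * symbol_op U W g x)"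
  shows "(Y ^^ n) (\<lambda>t. exp (A * t)) = (\<lambda>x. (deriv ^^ n) (\<lambda>w. exp (Z w * x)) (V A))"
proof (induction n)
  case 0
  show ?case using Z A by simp
next
  case (Suc n)
  define S where "S = V ` U"
  \<comment> \<open>No regularity of \<open>Z\<close> is assumed; it is inherited from a holomorphic
    inverse \<open>Z'\<close> that agrees with \<open>Z\<close> on \<open>S\<close>.\<close>
  obtain Z' where Z': "Z' holomorphic_on S"
    "\<And>z. z \<in> U \<Longrightarrow> deriv V z * deriv Z' (V z) = 1" "\<And>z. z \<in> U \<Longrightarrow> Z' (V z) = z"
    using holomorphic_has_inverse[OF V(1) U V(2)] unfolding S_def by metis
  have S: "open S"
    unfolding S_def using open_mapping_thm3[OF V(1) U V(2)] .
  have ZZ': "Z w = Z' w" if "w \<in> S" for w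
    using that Z Z'(3) by (auto simp: S_def)
  have Zhol: "Z holomorphic_on S"
    using Z'(1) ZZ' by (simp cong: holomorphic_cong)
  have ZS: "Z ` S \<subseteq> U" using Z by (auto simp: S_def)
  \<comment> \<open>The product identity for \<open>deriv V\<close> and \<open>deriv Z'\<close>
    shows that \<open>deriv V\<close> has no zero on \<open>U\<close>.\<close>
  have W: "W holomorphic_on U"
    unfolding W_def using V U Z'(2)
    by (intro holomorphic_intros holomorphic_deriv) (auto, metis mult_zero_left zero_neq_one)
  \<comment> \<open>This is the differential equation Z' = W(Z), the link between the symbol
    \<open>W\<close> and differentiation in \<open>w\<close>.\<close>
  have dZ: "(Z has_field_derivative W (Z w)) (at w)" if "w \<in> S" for w
  proof -
    have "deriv Z' w = W (Z w)"
      using that Z'(2) Z by (auto simp: S_def W_def divide_simps) (metis mult.commute mult_zero_left zero_neq_one)+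
    then have "(Z' has_field_derivative W (Z w)) (at w)"
      using holomorphic_derivI[OF Z'(1) S that] by simp
    then show ?thesis
      by (rule has_field_derivative_transform_within_open[OF _ S that]) (simp add: ZZ')
  qed
  have VA: "V A \<in> S" "Z (V A) = A" using A Z by (auto simp: S_def)
  obtain C where C: "\<And>h w. h holomorphic_on U \<Longrightarrow> w \<in> S \<Longrightarrow>
      (deriv ^^ n) (\<lambda>w. h (Z w)) w = (\<Sum>k\<le>n. C k w * (deriv ^^ k) h (Z w))"
    using higher_deriv_compose_expansion[OF S Zhol U ZS, of n] by blast
  define c where "c = (\<lambda>(k, a::complex). C k (V A))"
  have "(\<lambda>x. (deriv ^^ n) (\<lambda>w. exp (Z w * x)) (V A)) = exp_comb ({..n} \<times> {A}) c"
  proof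
    fix x
    have "(\<lambda>a. exp (a * x)) holomorphic_on U" by (intro holomorphic_intros)
    from C[OF this VA(1)] show "(deriv ^^ n) (\<lambda>w. exp (Z w * x)) (V A) = exp_comb ({..n} \<times> {A}) c x"
      by (simp add: VA exp_comb_def c_def exp_monom_def deriv_exp_linear_iter flip: sum.cartesian_product)
  qed
  then have "(Y ^^ Suc n) (\<lambda>t. exp (A * t)) = Y (exp_comb ({..n} \<times> {A}) c)"
    by (simp add: Suc.IH)
  also have "\<dots> = (\<lambda>x. x * (\<Sum>k\<le>n. C k (V A) * (deriv ^^ k) (\<lambda>a. W a * exp (a * x)) A))"
    unfolding Y_def using A
    by (subst symbol_op_exp_comb) (auto simp: c_def simp flip: sum.cartesian_product)
  also have "\<dots> = (\<lambda>x. (deriv ^^ Suc n) (\<lambda>w. exp (Z w * x)) (V A))"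
  proof
    fix x
    have hol: "(\<lambda>a. W a * exp (a * x)) holomorphic_on U"
      using W by (intro holomorphic_intros)
    have hol': "(\<lambda>w. W (Z w) * exp (Z w * x)) holomorphic_on S"
      using holomorphic_on_compose_gen[OF Zhol hol ZS] by (simp add: o_def)
    \<comment> \<open>The same \<open>C\<close> is now used with \<open>W a * exp (a * x)\<close> in
      the role of \<open>h\<close>, reading the expansion from right to left.\<close>
    have "x * (\<Sum>k\<le>n. C k (V A) * (deriv ^^ k) (\<lambda>a. W a * exp (a * x)) A)
        = x * (deriv ^^ n) (\<lambda>w. W (Z w) * exp (Z w * x)) (V A)"
      using C[OF hol VA(1)] VA(2) by simp
    also have "\<dots> = (deriv ^^ n) (\<lambda>w. x * (W (Z w) * exp (Z w * x))) (V A)"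
      using higher_deriv_cmult[OF hol' VA(1) S, of n x] by simp
    \<comment> \<open>The two functions agree only on \<open>S\<close>, so the iterated derivatives
      are compared through equality near \<open>V A\<close>.\<close>
    also have "\<dots> = (deriv ^^ n) (deriv (\<lambda>w. exp (Z w * x))) (V A)"
    proof (rule higher_deriv_cong_ev)
      have "x * (W (Z w) * exp (Z w * x)) = deriv (\<lambda>w. exp (Z w * x)) w" if "w \<in> S" for w
        by (rule DERIV_imp_deriv[symmetric]) (auto intro!: derivative_eq_intros dZ that)
      then show "\<forall>\<^sub>F w in nhds (V A). x * (W (Z w) * exp (Z w * x)) = deriv (\<lambda>w. exp (Z w * x)) w"
        using eventually_nhds_in_open[OF S VA(1)] by (auto elim: eventually_mono)
    qed simp
    finally show "x * (\<Sum>k\<le>n. C k (V A) * (deriv ^^ k) (\<lambda>a. W a * exp (a * x)) A)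
        = (deriv ^^ Suc n) (\<lambda>w. exp (Z w * x)) (V A)"
      by (simp only: funpow_Suc_right o_apply)
  qed
  finally show ?case .
qed

theorem theorem2p3:
  fixes V Z W :: "complex \<Rightarrow> complex" and U :: "complex set"
    and Y :: "(complex \<Rightarrow> complex) \<Rightarrow> complex \<Rightarrow> complex"
  assumes "open U" and "0 \<in> U"
    and "V holomorphic_on U" and "inj_on V U"
    and "V 0 = 0" and "deriv V 0 \<noteq> 0"
    and "\<forall>z\<in>U. Z (V z) = z"
    and "W = (\<lambda>z. 1 / deriv V z)"
    and "Y = (\<lambda>g x. x * symbol_op U W g x)"
  shows "(\<forall>A\<in>U. \<forall>\<^sub>F v in nhds 0. v + V A \<in> V ` U \<and>
            (\<forall>x. exp_op_converges v Y (\<lambda>t. exp (A * t)) x \<and>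
                 exp_op v Y (\<lambda>t. exp (A * t)) x = exp (x * Z (v + V A)))) \<and>
         (\<forall>\<^sub>F v in nhds 0. v \<in> V ` U \<and>
            (\<forall>x. exp_op_converges v Y (\<lambda>t. 1) x \<and>
                 exp_op v Y (\<lambda>t. 1) x = exp (x * Z v)))"
proof -
  have *: "\<forall>\<^sub>F v in nhds 0. v + V A \<in> V ` U \<and>
            (\<forall>x. exp_op_converges v Y (\<lambda>t. exp (A * t)) x \<and>
                 exp_op v Y (\<lambda>t. exp (A * t)) x = exp (x * Z (v + V A)))" if A: "A \<in> U" for A
  proof -
    have iter: "(Y ^^ n) (\<lambda>t. exp (A * t)) = (\<lambda>x. (deriv ^^ n) (\<lambda>w. exp (Z w * x)) (V A))" for n
      using assms(7) by (intro Y_iter_exp[OF assms(1,3,4) _ A assms(8,9)]) auto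
    have S: "open (V ` U)" using open_mapping_thm3[OF assms(3,1,4)] .
    obtain Z' where "Z' holomorphic_on V ` U" "\<And>z. z \<in> U \<Longrightarrow> Z' (V z) = z"
      using holomorphic_has_inverse[OF assms(3,1,4)] by metis
    then have Zhol: "Z holomorphic_on V ` U"
      using assms(7) by (subst holomorphic_cong[OF refl, of _ _ Z']) auto
    obtain r where r: "r > 0" "ball (V A) r \<subseteq> V ` U"
      using S A openE by blast
    have "\<forall>\<^sub>F v in nhds 0. v \<in> ball 0 r"
      using r by (intro eventually_nhds_in_open) auto
    then show ?thesis
    proof eventually_elim
      case (elim v)
      then have v: "v + V A \<in> ball (V A) r" by (simp add: dist_norm)
      \<comment> \<open>This is the Taylor series of \<open>exp (Z w * x)\<close> about
        \<open>V A\<close>, with increment \<open>v\<close>; the radius \<open>r\<close> was fixed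
        before \<open>x\<close>.\<close>
      have "(\<lambda>n. v ^ n / fact n * (Y ^^ n) (\<lambda>t. exp (A * t)) x) sums exp (x * Z (v + V A))" for x
      proof -
        have "(\<lambda>w. exp (Z w * x)) holomorphic_on ball (V A) r"
          using Zhol r(2) by (intro holomorphic_intros) (rule holomorphic_on_subset)
        from holomorphic_power_series[OF this v]
        show ?thesis
          unfolding iter by (simp add: mult_ac)
      qed
      then show ?case
        using v r(2) unfolding exp_op_converges_def exp_op_def
        by (auto simp: sums_iff)
    qed
  qed
  \<comment> \<open>The second claim is the case \<open>A = 0\<close>, where the exponential is
    constantly 1 and \<open>V 0 = 0\<close>.\<close>
  show ?thesis
    using * *[OF assms(2)] assms(5) by simp
qed

end
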